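(* Let $n,m\in\mathbb{N}$ with $n-1\le m<\binom{n}{2}$, and let $G$ be a connected graph of order $n$ and size $m$. If $I$ is a nondecreasing distance-based topological index, then \[ I(G)\le I(PK_{n,m}). \] If $I$ is a nonincreasing distance-based topological index, then \[ I(G)\ge I(PK_{n,m}). \]
   Context: All graphs are finite and simple. The order of a graph is its number of vertices, and its size is its number of edges. For a connected graph $G$, $d_G(u,v)$ is the usual shortest-path distance. The distance sequence $\mathcal{D}(G)$ of a connected graph $G$ is the nondecreasing sequence (of length $\binom{n}{2}$ if $G$ has order $n$) of the distances between all unordered pairs of distinct vertices of $G$, with repetitions. A topological index $I$, assigning a real number to each connected graph, is distance-based if it can be expressed in the form $I(G)=g(\mathcal{D}(G))$, where $g$ is a real-valued function defined on the set of all finite sequences of positive integers. It is called nondecreasing (nonincreasing) if $g$, when restricted to sequences of any fixed length, is nondecreasing (nonincreasing) in every coordinate. A path-complete graph is a graph obtained from the disjoint union of a path and a complete graph by joining one end of the path to one or more vertices of the complete graph. For given $n,m\in\mathbb{N}$ with $n-1\le m<\binom{n}{2}$ there exists a unique (up to isomorphism) path-complete graph of order $n$ and size $m$; it is denoted $PK_{n,m}$. *)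

theory Defs
  imports Complex_Main "HOL-Library.Multiset" "HOL-Library.Ramsey"
begin

section \<open>Finite simple graphs\<close>

text \<open>A graph is given by its vertex set and its set of edges, where an edge is a set of two
  vertices; \<^term>\<open>nsets V 2\<close> is the set of all two-element subsets of \<^term>\<open>V\<close>.\<close>

type_synonym 'a ugraph = "'a set \<times> 'a set set"

abbreviation verts :: "'a ugraph \<Rightarrow> 'a set" where "verts G \<equiv> fst G"

abbreviation edges :: "'a ugraph \<Rightarrow> 'a set set" where "edges G \<equiv> snd G"

definition simple_graph :: "'a ugraph \<Rightarrow> bool" where
  "simple_graph G \<longleftrightarrow> finite (verts G) \<and> edges G \<subseteq> nsets (verts G) 2"

definition graph_order :: "'a ugraph \<Rightarrow> nat" where
  "graph_order G = card (verts G)"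

definition graph_size :: "'a ugraph \<Rightarrow> nat" where
  "graph_size G = card (edges G)"

definition path_between :: "'a ugraph \<Rightarrow> 'a \<Rightarrow> 'a \<Rightarrow> 'a list \<Rightarrow> bool" where
  "path_between G u v xs \<longleftrightarrow> xs \<noteq> [] \<and> hd xs = u \<and> last xs = v \<and> distinct xs \<and>
     set xs \<subseteq> verts G \<and> successively (\<lambda>x y. {x, y} \<in> edges G) xs"

definition connected_graph :: "'a ugraph \<Rightarrow> bool" where
  "connected_graph G \<longleftrightarrow> simple_graph G \<and> verts G \<noteq> {} \<and>
     (\<forall>u\<in>verts G. \<forall>v\<in>verts G. \<exists>xs. path_between G u v xs)"

text \<open>The length of a path is its number of edges, i.e. \<^term>\<open>length xs - 1\<close> for the list
  \<^term>\<open>xs\<close> of its vertices.\<close>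

definition graph_dist :: "'a ugraph \<Rightarrow> 'a \<Rightarrow> 'a \<Rightarrow> nat" where
  "graph_dist G u v = (LEAST k. \<exists>xs. path_between G u v xs \<and> length xs = Suc k)"

section \<open>The distance sequence\<close>

text \<open>The distance of an unordered pair is well defined since \<^term>\<open>graph_dist G\<close> is
  symmetric; see \<open>pair_dist_eq\<close> below.\<close>

definition pair_dist :: "'a ugraph \<Rightarrow> 'a set \<Rightarrow> nat" where
  "pair_dist G p = (THE d. \<exists>u v. p = {u, v} \<and> d = graph_dist G u v)"

definition distance_sequence :: "'a ugraph \<Rightarrow> nat list" where
  "distance_sequence G =
     sorted_list_of_multiset (image_mset (pair_dist G) (mset_set (nsets (verts G) 2)))"

lemma path_between_rev:
  assumes "path_between G u v xs"
  shows "path_between G v u (rev xs)"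
  using assms by (auto simp: path_between_def hd_rev last_rev insert_commute)

lemma graph_dist_commute: "graph_dist G u v = graph_dist G v u"
proof -
  have "(\<exists>xs. path_between G u v xs \<and> length xs = Suc k) \<longleftrightarrow>
        (\<exists>xs. path_between G v u xs \<and> length xs = Suc k)" for k
    by (metis path_between_rev length_rev)
  then show ?thesis unfolding graph_dist_def by simp
qed

lemma pair_dist_eq: "pair_dist G {u, v} = graph_dist G u v"
  unfolding pair_dist_def
  by (rule the_equality) (auto simp: doubleton_eq_iff graph_dist_commute)

lemma length_distance_sequence:
  assumes "finite (verts G)"
  shows "length (distance_sequence G) = graph_order G choose 2"
proof -
  have "length (distance_sequence G) = size (mset (distance_sequence G))"
    by (simp only: size_mset)
  also have "\<dots> = card (nsets (verts G) 2)"
    unfolding distance_sequence_def mset_sorted_list_of_multiset by simp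
  finally show ?thesis by (simp add: card_nsets graph_order_def)
qed

section \<open>Distance-based topological indices\<close>

text \<open>The values of an index on arguments that are not connected graphs, and of \<^term>\<open>g\<close> on
  lists containing 0, are irrelevant and left unconstrained.\<close>

definition index_via :: "(nat list \<Rightarrow> real) \<Rightarrow> ('a ugraph \<Rightarrow> real) \<Rightarrow> bool" where
  "index_via g I \<longleftrightarrow> (\<forall>G. connected_graph G \<longrightarrow> I G = g (distance_sequence G))"

definition nondecreasing_coords :: "(nat list \<Rightarrow> real) \<Rightarrow> bool" where
  "nondecreasing_coords g \<longleftrightarrow>
     (\<forall>xs i y. (\<forall>x\<in>set xs. 0 < x) \<and> i < length xs \<and> xs ! i \<le> y \<longrightarrow> g xs \<le> g (xs[i := y]))"

definition nonincreasing_coords :: "(nat list \<Rightarrow> real) \<Rightarrow> bool" where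
  "nonincreasing_coords g \<longleftrightarrow>
     (\<forall>xs i y. (\<forall>x\<in>set xs. 0 < x) \<and> i < length xs \<and> xs ! i \<le> y \<longrightarrow> g xs \<ge> g (xs[i := y]))"

definition nondecreasing_distance_based :: "('a ugraph \<Rightarrow> real) \<Rightarrow> bool" where
  "nondecreasing_distance_based I \<longleftrightarrow> (\<exists>g. index_via g I \<and> nondecreasing_coords g)"

definition nonincreasing_distance_based :: "('a ugraph \<Rightarrow> real) \<Rightarrow> bool" where
  "nonincreasing_distance_based I \<longleftrightarrow> (\<exists>g. index_via g I \<and> nonincreasing_coords g)"

section \<open>Path-complete graphs\<close>

definition path_edges :: "'a list \<Rightarrow> 'a set set" where
  "path_edges ps = {{ps ! i, ps ! Suc i} | i. Suc i < length ps}"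

text \<open>The path has the vertices \<^term>\<open>ps\<close>, in this order, the complete graph has the vertex
  set \<^term>\<open>K\<close>, and \<^term>\<open>last ps\<close> is joined to the vertices in \<^term>\<open>S\<close>.\<close>

definition path_complete :: "'a ugraph \<Rightarrow> bool" where
  "path_complete P \<longleftrightarrow> (\<exists>ps K S.
     ps \<noteq> [] \<and> distinct ps \<and> finite K \<and> set ps \<inter> K = {} \<and> S \<subseteq> K \<and> S \<noteq> {} \<and>
     P = (set ps \<union> K, path_edges ps \<union> nsets K 2 \<union> (\<lambda>s. {last ps, s}) ` S))"

definition is_PK :: "nat \<Rightarrow> nat \<Rightarrow> 'a ugraph \<Rightarrow> bool" where
  "is_PK n m P \<longleftrightarrow> path_complete P \<and> graph_order P = n \<and> graph_size P = m"

lemma card_path_edges: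
  assumes "distinct ps"
  shows "card (path_edges ps) = length ps - 1"
proof -
  have eq: "path_edges ps = (\<lambda>i. {ps ! i, ps ! Suc i}) ` {..<length ps - 1}"
    unfolding path_edges_def by auto
  have "inj_on (\<lambda>i. {ps ! i, ps ! Suc i}) {..<length ps - 1}"
    using assms by (auto simp: inj_on_def doubleton_eq_iff nth_eq_iff_index_eq)
  then show ?thesis unfolding eq by (simp add: card_image)
qed

text \<open>Every set of \<^term>\<open>n\<close> vertices carries a path-complete graph of size \<^term>\<open>m\<close>.\<close>

lemma is_PK_exists:
  fixes V :: "'a set"
  assumes V: "finite V" "card V = n" and m: "n - 1 \<le> m" "m < n choose 2"
  shows "\<exists>P. verts P = V \<and> is_PK n m P"
proof -
  define Q where "Q k \<longleftrightarrow> 1 \<le> k \<and> k \<le> n \<and> (k choose 2) + (n - k) \<le> m" for k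
  have n: "n \<noteq> 0" using m by (cases n) (auto simp: numeral_2_eq_2)
  have Q1: "Q 1" using n m by (simp add: Q_def numeral_2_eq_2)
  have "\<exists>k. Q k \<and> (\<forall>y. Q y \<longrightarrow> y \<le> k)"
    using Q1 by (intro Nat.ex_has_greatest_nat[where k = 1 and b = "Suc n"]) (auto simp: Q_def)
  then obtain k where k: "Q k" "\<And>y. Q y \<Longrightarrow> y \<le> k" by blast
  have kn: "k < n" using k(1) m by (cases "k = n") (auto simp: Q_def)
  have "\<not> Q (Suc k)" using k(2) by fastforce
  moreover have "(Suc k choose 2) = k + (k choose 2)"
    by (simp add: numeral_2_eq_2)
  ultimately have ub: "m < k + (k choose 2) + (n - Suc k)"
    using kn by (auto simp: Q_def)
  define j where "j = m + 1 - ((k choose 2) + (n - k))"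
  have j: "1 \<le> j" "j \<le> k" "(k choose 2) + (n - k - 1) + j = m"
    using k(1) ub kn by (auto simp: j_def Q_def)
  obtain K where K: "K \<subseteq> V" "card K = k"
    using kn V by (metis obtain_subset_with_card_n less_imp_le)
  obtain S where S: "S \<subseteq> K" "card S = j"
    using j(2) K by (metis obtain_subset_with_card_n)
  have fin: "finite K" "finite S" "finite (V - K)"
    using V K S by (auto intro: finite_subset)
  obtain ps where ps: "set ps = V - K" "distinct ps"
    using fin(3) finite_distinct_list by blast
  have len: "length ps = n - k"
    using ps V K fin by (metis card_Diff_subset distinct_card)
  have ne: "ps \<noteq> []" using len kn by auto
  have "S \<noteq> {}" using S j by auto
  let ?J = "(\<lambda>s. {last ps, s}) ` S"
  let ?P = "(set ps \<union> K, path_edges ps \<union> nsets K 2 \<union> ?J)"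
  have "path_complete ?P"
    unfolding path_complete_def
    using ne ps fin S \<open>S \<noteq> {}\<close> by (intro exI[of _ ps] exI[of _ K] exI[of _ S]) auto
  moreover have VP: "set ps \<union> K = V" using ps K by auto
  moreover have "card (path_edges ps \<union> nsets K 2 \<union> ?J) = m"
  proof -
    have last: "last ps \<notin> K" using ne ps last_in_set by fastforce
    have sub: "e \<subseteq> set ps" "e \<noteq> {}" if "e \<in> path_edges ps" for e
      using that by (auto simp: path_edges_def)
    have "path_edges ps \<subseteq> Pow (set ps)" using sub by auto
    then have f1: "finite (path_edges ps)" by (rule finite_subset) simp
    have f2: "finite (nsets K 2)" using fin by (simp add: finite_imp_finite_nsets)
    have d1: "path_edges ps \<inter> nsets K 2 = {}"
      using sub ps by (fastforce simp: nsets_def)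
    have d2: "(path_edges ps \<union> nsets K 2) \<inter> ?J = {}"
      using sub ps last S by (fastforce simp: nsets_def)
    have "inj_on (\<lambda>s. {last ps, s}) S"
      by (auto simp: inj_on_def doubleton_eq_iff)
    then have "card ?J = j" using S by (simp add: card_image)
    then have "card (path_edges ps \<union> nsets K 2 \<union> ?J) = (n - k - 1) + (k choose 2) + j"
      using f1 f2 d1 d2 fin ps len K
      by (simp add: card_Un_disjoint card_path_edges card_nsets)
    then show ?thesis using j by simp
  qed
  ultimately show ?thesis
    using V by (intro exI[of _ ?P]) (simp add: is_PK_def graph_order_def graph_size_def)
qed

end

theory Submission
  imports Defs
begin

text \<open>The distance sequences are compared by counting, for each \<open>r \<ge> 1\<close>, the pairs at distance
  greater than \<open>r\<close>. If a connected graph \<open>G\<close> of order \<open>n\<close> and size \<open>m\<close> has such a pair, it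
  contains a geodesic with \<open>r + 2\<close> vertices. All but \<open>r + 2\<close> of the pairs on the geodesic have a
  distance between 2 and \<open>r\<close>, and each other vertex contributes at least \<open>r - 1\<close> further pairs
  with this property. Hence at most \<open>(n - r choose 2) + (n - 1) - m\<close> pairs are at distance greater
  than \<open>r\<close>. A path-complete graph has at least that many such pairs, since its vertices can be
  arranged in layers whose differences bound the distances from below.\<close>

section \<open>Paths and distances\<close>

lemma in_nsets_2_iff: "p \<in> nsets A 2 \<longleftrightarrow> (\<exists>x\<in>A. \<exists>y\<in>A. x \<noteq> y \<and> p = {x, y})"
  by (auto simp: nsets_def card_2_iff)

lemma simple_graph_edgeD:
  assumes "simple_graph G" "{u, v} \<in> edges G"
  shows "u \<in> verts G" "v \<in> verts G" "u \<noteq> v"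
proof -
  have "{u, v} \<in> nsets (verts G) 2" using assms unfolding simple_graph_def by blast
  then show "u \<in> verts G" "v \<in> verts G" "u \<noteq> v" by (auto simp: in_nsets_2_iff doubleton_eq_iff)
qed

text \<open>If \<open>w\<close> already lies on the path, its suffix starting at \<open>w\<close> is
  kept; otherwise \<open>w\<close> is put in front. Either way the vertices stay distinct and at
  most one is added.\<close>

lemma path_between_step:
  assumes p: "path_between G u v xs" and e: "{w, u} \<in> edges G" and w: "w \<in> verts G"
  shows "\<exists>ys. path_between G w v ys \<and> length ys \<le> Suc (length xs)"
proof (cases "w \<in> set xs")
  case True
  then obtain as bs where "xs = as @ w # bs" by (meson split_list)
  then have "path_between G w v (w # bs)"
    using p by (auto simp: path_between_def successively_append_iff)
  then show ?thesis using \<open>xs = as @ w # bs\<close> by (intro exI[of _ "w # bs"]) auto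
next
  case False
  then have "path_between G w v (w # xs)"
    using p e w by (auto simp: path_between_def successively_Cons)
  then show ?thesis by (intro exI[of _ "w # xs"]) auto
qed

text \<open>Plain concatenation could repeat vertices. The vertices of the first path are therefore
  put in front of the second one at a time, using \<open>path_between_step\<close>.\<close>

lemma path_between_trans:
  assumes "path_between G u w xs" "path_between G w v ys"
  shows "\<exists>zs. path_between G u v zs"
  using assms(1)
proof (induction xs arbitrary: u)
  case Nil
  then show ?case by (simp add: path_between_def)
next
  case (Cons x xs)
  show ?case
  proof (cases xs)
    case Nil
    then show ?thesis using Cons.prems assms(2) by (auto simp: path_between_def)
  next
    case xs: (Cons y zs)
    then have "path_between G y w xs" "{u, y} \<in> edges G" "u \<in> verts G"
      using Cons.prems by (auto simp: path_between_def)
    then show ?thesis using Cons.IH path_between_step by metis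
  qed
qed

lemma graph_dist_le: "path_between G u v xs \<Longrightarrow> graph_dist G u v \<le> length xs - 1"
  unfolding graph_dist_def
  by (rule Least_le) (auto simp: path_between_def)

section \<open>Metric properties of the distance in a connected graph\<close>

context
  fixes G :: "'a ugraph"
  assumes conn: "connected_graph G"
begin

private abbreviation "V \<equiv> verts G"
private abbreviation "d \<equiv> graph_dist G"

lemma connected_graph_simple: "simple_graph G"
  using conn by (simp add: connected_graph_def)

lemma finite_verts: "finite V"
  using connected_graph_simple by (simp add: simple_graph_def)

lemma shortest_path:
  assumes "u \<in> V" "v \<in> V"
  shows "\<exists>xs. path_between G u v xs \<and> length xs = Suc (d u v)"
proof -
  obtain xs where xs: "path_between G u v xs"
    using conn assms by (auto simp: connected_graph_def)
  then have "length xs = Suc (length xs - 1)" by (auto simp: path_between_def)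
  with xs have "\<exists>k xs. path_between G u v xs \<and> length xs = Suc k" by blast
  then show ?thesis unfolding graph_dist_def by (rule LeastI_ex)
qed

lemma dist_self [simp]: "u \<in> V \<Longrightarrow> d u u = 0"
  using graph_dist_le[of G u u "[u]"] by (simp add: path_between_def)

lemma dist_eq_0:
  assumes "u \<in> V" "v \<in> V" "d u v = 0"
  shows "u = v"
  using shortest_path[OF assms(1,2)] assms(3) by (auto simp: path_between_def length_Suc_conv)

lemma dist_edge_le:
  assumes "{u, w} \<in> edges G" "v \<in> V"
  shows "d u v \<le> Suc (d w v)"
proof -
  have "w \<in> V" "u \<in> V" using simple_graph_edgeD[OF connected_graph_simple assms(1)] by auto
  then obtain xs where xs: "path_between G w v xs" "length xs = Suc (d w v)"
    using shortest_path assms by blast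
  then obtain ys where "path_between G u v ys" "length ys \<le> Suc (length xs)"
    using path_between_step assms \<open>u \<in> V\<close> by metis
  then show ?thesis using graph_dist_le[of G u v ys] xs(2) by linarith
qed

text \<open>The second vertex of a shortest path is one step closer to \<open>v\<close>. This drives
  the inductions on the distance below.\<close>

lemma dist_step:
  assumes uv: "u \<in> V" "v \<in> V" "u \<noteq> v"
  shows "\<exists>w. {u, w} \<in> edges G \<and> d u v = Suc (d w v)"
proof -
  obtain xs where xs: "path_between G u v xs" "length xs = Suc (d u v)"
    using shortest_path uv by blast
  then obtain y zs where zs: "xs = u # y # zs"
    using uv by (cases xs rule: remdups_adj.cases) (auto simp: path_between_def)
  then have e: "{u, y} \<in> edges G" and p: "path_between G y v (y # zs)"
    using xs by (auto simp: path_between_def)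
  have "d y v \<le> length zs" using graph_dist_le[OF p] by simp
  with dist_edge_le[OF e uv(2)] xs zs have "d u v = Suc (d y v)" by simp
  with e show ?thesis by blast
qed

lemma dist_triangle:
  assumes "u \<in> V" "v \<in> V" "w \<in> V"
  shows "d u w \<le> d u v + d v w"
  using assms
proof (induction "d u v" arbitrary: u)
  case 0
  then show ?case using dist_eq_0[of u v] by simp
next
  case (Suc k)
  then have "u \<noteq> v" by auto
  then obtain y where y: "{u, y} \<in> edges G" "d u v = Suc (d y v)"
    using dist_step Suc by blast
  then have "y \<in> V" using simple_graph_edgeD[OF connected_graph_simple] by blast
  then have "d y w \<le> d y v + d v w" using Suc y by simp
  then show ?case using dist_edge_le[OF y(1)] Suc.prems y by fastforce
qed

lemma dist_eq_1_iff:
  assumes "u \<in> V" "v \<in> V"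
  shows "d u v = 1 \<longleftrightarrow> {u, v} \<in> edges G"
proof
  assume "d u v = 1"
  then have "u \<noteq> v" using assms by auto
  then obtain w where w: "{u, w} \<in> edges G" "d u v = Suc (d w v)"
    using dist_step assms by blast
  then have "w = v"
    using \<open>d u v = 1\<close> dist_eq_0[of w v] assms simple_graph_edgeD(2)[OF connected_graph_simple w(1)] by simp
  with w show "{u, v} \<in> edges G" by simp
next
  assume e: "{u, v} \<in> edges G"
  then have "u \<noteq> v" using simple_graph_edgeD[OF connected_graph_simple] by blast
  then have "d u v \<noteq> 0" using dist_eq_0 assms by blast
  then show "d u v = 1" using dist_edge_le[OF e assms(2)] assms(2) by simp
qed

text \<open>A geodesic from a neighbour \<open>w\<close> of \<open>u\<close> that is one step closer
  to \<open>v\<close> is extended by \<open>u\<close> at the front; only the distances from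
  \<open>u\<close> have to be computed anew.\<close>

lemma geodesic:
  assumes "u \<in> V" "v \<in> V"
  shows "\<exists>q. q 0 = u \<and> q (d u v) = v \<and> (\<forall>i\<le>d u v. q i \<in> V) \<and>
    (\<forall>j\<le>d u v. \<forall>i\<le>j. d (q i) (q j) = j - i)"
  using assms
proof (induction "d u v" arbitrary: u)
  case 0
  then show ?case using dist_eq_0[of u v] by (intro exI[of _ "\<lambda>_. u"]) auto
next
  case (Suc k)
  then have "u \<noteq> v" by auto
  then obtain w where w: "{u, w} \<in> edges G" "d u v = Suc (d w v)"
    using dist_step Suc by blast
  then have wV: "w \<in> V" using simple_graph_edgeD[OF connected_graph_simple] by blast
  have "k = d w v" using Suc.hyps(2) w(2) by simp
  from Suc.hyps(1)[OF this wV Suc.prems(2)] obtain q where q: "q 0 = w" "q (d w v) = v"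
    "\<And>i. i \<le> d w v \<Longrightarrow> q i \<in> V" "\<And>i j. j \<le> d w v \<Longrightarrow> i \<le> j \<Longrightarrow> d (q i) (q j) = j - i"
    by blast
  \<comment> \<open>The edge to \<open>w\<close> bounds the distance by \<open>Suc j\<close> from
    above. A smaller value would make the route through \<open>q j\<close> shorter than
    \<open>d u v\<close>.\<close>
  have far: "d u (q j) = Suc j" if j: "j \<le> d w v" for j
  proof -
    have "d u (q j) \<le> Suc (d w (q j))" using dist_edge_le[OF w(1)] q(3)[OF j] .
    moreover have "d w (q j) = j" using q(4)[OF j, of 0] q(1) by simp
    moreover have "d (q j) v = d w v - j" using q(4)[of "d w v" j] q(2) j by simp
    moreover have "d u v \<le> d u (q j) + d (q j) v"
      using dist_triangle Suc.prems q(3)[OF j] by blast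
    ultimately show ?thesis using w(2) j by linarith
  qed
  define q' where "q' = case_nat u q"
  have "d (q' i) (q' j) = j - i" if ij: "j \<le> d u v" "i \<le> j" for i j
  proof (cases j)
    case 0
    then show ?thesis using ij Suc.prems by (simp add: q'_def)
  next
    case (Suc j')
    then have "j' \<le> d w v" using ij w(2) by simp
    then show ?thesis using far q(4)[of j'] Suc ij(2) by (cases i) (simp_all add: q'_def)
  qed
  moreover have "q' i \<in> V" if "i \<le> d u v" for i
    using that q(3)[of "i - 1"] w(2) Suc.prems(1) by (cases i) (simp_all add: q'_def)
  moreover have "q' 0 = u" "q' (d u v) = v" by (simp_all add: q'_def w(2) q(2))
  ultimately show ?case by blast
qed

text \<open>A function that changes by at most one along every edge bounds distances from below.
  Symmetry of edges lets the one-sided hypothesis cover both directions.\<close>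

lemma dist_ge_layer_difference:
  fixes L :: "'a \<Rightarrow> nat"
  assumes L: "\<And>x y. {x, y} \<in> edges G \<Longrightarrow> L y \<le> Suc (L x)"
    and uv: "u \<in> V" "v \<in> V"
  shows "L v \<le> L u + d u v"
  using uv
proof (induction "d u v" arbitrary: u)
  case 0
  then have "u = v" using dist_eq_0 by metis
  then show ?case by simp
next
  case (Suc k)
  then have "u \<noteq> v" using dist_self by fastforce
  then obtain y where y: "{u, y} \<in> edges G" "d u v = Suc (d y v)"
    using dist_step[OF Suc.prems \<open>u \<noteq> v\<close>] by blast
  then have "y \<in> V" using simple_graph_edgeD(2)[OF connected_graph_simple] by blast
  have "k = d y v" using Suc.hyps(2) y(2) by simp
  then have "L v \<le> L y + d y v" using Suc.hyps(1)[OF _ \<open>y \<in> V\<close> uv(2)] by simp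
  then show ?case using L[OF y(1)] y(2) by linarith
qed

end

section \<open>Pairs at large distance\<close>

definition far_pairs :: "'a ugraph \<Rightarrow> nat \<Rightarrow> 'a set set" where
  "far_pairs G r = {p \<in> nsets (verts G) 2. r < pair_dist G p}"

lemma discrete_ivt:
  fixes f :: "nat \<Rightarrow> nat"
  assumes step: "\<And>i. i < N \<Longrightarrow> f (Suc i) \<le> Suc (f i) \<and> f i \<le> Suc (f (Suc i))"
    and ab: "a \<le> N" "b \<le> N" "f a \<le> t" "t \<le> f b"
  shows "\<exists>i\<le>N. f i = t"
proof -
  have step': "\<bar>int (f (Suc i)) - int (f i)\<bar> \<le> 1" if "i < N" for i
    using step[OF that] by linarith
  show ?thesis
  proof (cases "a \<le> b")
    case True
    have "\<exists>i\<ge>a. i \<le> b \<and> int (f i) = int t"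
      by (rule nat_intermed_int_val) (use step' ab True in auto)
    then show ?thesis using ab(2) by (metis int_int_eq order_trans)
  next
    case False
    \<comment> \<open>With the endpoints in the reverse order the intermediate value property is
      applied to the negated function.\<close>
    have "\<exists>i\<ge>b. i \<le> a \<and> - int (f i) = - int t"
      by (rule nat_intermed_int_val) (use step' ab False in \<open>auto simp: abs_minus_commute\<close>)
    then show ?thesis using ab(1) by (metis int_int_eq neg_equal_iff_equal order_trans)
  qed
qed

lemma card_far_pairs_0:
  assumes "connected_graph G"
  shows "card (far_pairs G 0) = graph_order G choose 2"
proof -
  have "far_pairs G 0 = nsets (verts G) 2"
    using dist_eq_0[OF assms] by (fastforce simp: far_pairs_def in_nsets_2_iff pair_dist_eq)
  then show ?thesis by (simp add: graph_order_def card_nsets)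
qed

section \<open>Pairs at distance between 2 and \<open>r\<close>\<close>

definition mid_pairs :: "'a ugraph \<Rightarrow> nat \<Rightarrow> 'a set set" where
  "mid_pairs G r = {p \<in> nsets (verts G) 2. 2 \<le> pair_dist G p \<and> pair_dist G p \<le> r}"

text \<open>The edges are exactly the pairs at distance 1, so all pairs fall into three disjoint
  classes. For fixed order and size, an upper bound on far pairs thus amounts to a lower bound on
  mid pairs.\<close>

lemma card_far_mid_edges:
  assumes G: "connected_graph G" and r: "1 \<le> r"
  shows "card (far_pairs G r) + card (mid_pairs G r) + graph_size G = graph_order G choose 2"
proof -
  have fin: "finite (nsets (verts G) 2)"
    using finite_verts[OF G] by (simp add: finite_imp_finite_nsets)
  have E: "edges G = {p \<in> nsets (verts G) 2. pair_dist G p = 1}"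
  proof -
    have "edges G \<subseteq> nsets (verts G) 2" using connected_graph_simple[OF G] by (simp add: simple_graph_def)
    then show ?thesis
      using dist_eq_1_iff[OF G] by (fastforce simp: in_nsets_2_iff pair_dist_eq)
  qed
  have pos: "pair_dist G p \<noteq> 0" if "p \<in> nsets (verts G) 2" for p
    using that dist_eq_0[OF G] by (fastforce simp: in_nsets_2_iff pair_dist_eq)
  have "nsets (verts G) 2 = far_pairs G r \<union> mid_pairs G r \<union> edges G"
    using pos r unfolding E far_pairs_def mid_pairs_def by force
  moreover have "card (far_pairs G r \<union> mid_pairs G r \<union> edges G)
      = card (far_pairs G r) + card (mid_pairs G r) + card (edges G)"
  proof -
    have "finite (far_pairs G r)" "finite (mid_pairs G r)" "finite (edges G)"
      using fin unfolding E far_pairs_def mid_pairs_def by auto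
    moreover have "far_pairs G r \<inter> mid_pairs G r = {}"
      "(far_pairs G r \<union> mid_pairs G r) \<inter> edges G = {}"
      using r unfolding E far_pairs_def mid_pairs_def by auto
    ultimately show ?thesis by (simp add: card_Un_disjoint)
  qed
  ultimately show ?thesis
    by (simp add: graph_order_def graph_size_def card_nsets flip: \<open>nsets _ _ = _\<close>)
qed

text \<open>Each vertex outside a geodesic with \<open>r + 2\<close> vertices has at least \<open>r - 1\<close> partners at
  distance between 2 and \<open>r\<close> which lie on the geodesic or are closer to it. Counting only such
  partners makes sure that no pair is counted twice.\<close>

lemma card_mid_pairs_ge:
  assumes G: "connected_graph G" and r: "1 \<le> r"
    and q: "\<And>i. i \<le> Suc r \<Longrightarrow> q i \<in> verts G"
    and qd: "\<And>i j. j \<le> Suc r \<Longrightarrow> i \<le> j \<Longrightarrow> graph_dist G (q i) (q j) = j - i"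
  shows "(Suc (Suc r) choose 2) + (graph_order G - (r + 2)) * (r - 1)
    \<le> card (mid_pairs G r) + (r + 2)" (is "?lhs \<le> _") and "r + 2 \<le> graph_order G"
proof -
  let ?V = "verts G" and ?d = "graph_dist G"
  define Q where "Q = q ` {..Suc r}"
  have QV: "Q \<subseteq> ?V" using q by (auto simp: Q_def)
  have finV: "finite ?V" by (rule finite_verts[OF G])
  have finQ: "finite Q" by (simp add: Q_def)
  \<comment> \<open>With truncated subtraction one summand vanishes, so the sum is the absolute
    difference of \<open>i\<close> and \<open>j\<close>.\<close>
  have qd': "?d (q i) (q j) = (j - i) + (i - j)" if "i \<le> Suc r" "j \<le> Suc r" for i j
    using qd[of j i] qd[of i j] that graph_dist_commute[of G "q i" "q j"] by (cases "i \<le> j") auto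
  have inj: "inj_on q {..Suc r}"
  proof (rule inj_onI)
    fix i j assume ij: "i \<in> {..Suc r}" "j \<in> {..Suc r}" "q i = q j"
    then have "?d (q i) (q j) = 0" using q dist_self[OF G] by auto
    then show "i = j" using qd'[of i j] ij(1,2) by simp
  qed
  then have cardQ: "card Q = r + 2" by (simp add: Q_def card_image)
  then show n: "r + 2 \<le> graph_order G"
    unfolding graph_order_def using QV finV by (metis card_mono)
  define h where "h x = (MIN y\<in>Q. ?d x y)" for x
  have Qne: "Q \<noteq> {}" by (auto simp: Q_def)
  have h_le: "h x \<le> ?d x y" if "y \<in> Q" for x y
    unfolding h_def using finQ that by simp
  have h_att: "\<exists>y\<in>Q. h x = ?d x y" for x
    unfolding h_def using Min_in[of "?d x ` Q"] finQ Qne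
    by (metis finite_imageI imageE image_is_empty)
  \<comment> \<open>The last condition orients the pairs: two vertices outside \<open>Q\<close>
    cannot each belong to the set of the other, as \<open>h\<close> would have to decrease both
    ways.\<close>
  define A where "A x = {y \<in> ?V. 2 \<le> ?d x y \<and> ?d x y \<le> r \<and> (y \<in> Q \<or> h y < h x)}" for x
  have finA: "finite (A x)" for x using finV by (simp add: A_def)
  have card_A: "r - 1 \<le> card (A x)" if x: "x \<in> ?V" "x \<notin> Q" for x
  proof (cases "\<exists>b\<le>Suc r. r < ?d x (q b)")
    case True
    then obtain b where b: "b \<le> Suc r" "r < ?d x (q b)" by blast
    obtain a where a: "a \<le> Suc r" "h x = ?d x (q a)"
      using h_att[of x] by (auto simp: Q_def)
    \<comment> \<open>Some vertex of \<open>Q\<close> is farther than \<open>r\<close> from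
      \<open>x\<close>. Then each of the \<open>r - 1\<close> values \<open>t\<close> in
      \<open>{2..r}\<close> is the distance from \<open>x\<close> to a member of
      \<open>A x\<close>.\<close>
    have "t \<in> ?d x ` A x" if t: "2 \<le> t" "t \<le> r" for t
    proof (cases "t < h x")
      case True
      \<comment> \<open>Below \<open>h x\<close>, the value \<open>t\<close> is attained on a
        geodesic from \<open>x\<close> to a nearest vertex of \<open>Q\<close>, at a vertex closer
        to \<open>Q\<close> than \<open>x\<close>.\<close>
      obtain s where s: "s 0 = x" "s (?d x (q a)) = q a" "\<forall>i\<le>?d x (q a). s i \<in> ?V"
        "\<forall>j\<le>?d x (q a). \<forall>i\<le>j. ?d (s i) (s j) = j - i"
        using geodesic[OF G x(1) q[OF a(1)]] by blast
      have "?d x (s t) = t" using s True a(2) by (metis diff_zero le0 less_imp_le)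
      moreover have "?d (s t) (q a) = h x - t" using s True a(2) by (metis order_refl less_imp_le)
      then have "h (s t) < h x" using h_le[of "q a" "s t"] True t a(1) by (auto simp: Q_def)
      moreover have "s t \<in> ?V" using s(3) True a(2) by simp
      ultimately have "s t \<in> A x" using t by (simp add: A_def)
      then show ?thesis using \<open>?d x (s t) = t\<close> by force
    next
      case False
      \<comment> \<open>From \<open>h x\<close> upwards, the value \<open>t\<close> is attained on
        \<open>Q\<close> itself: the distance from \<open>x\<close> changes by at most one per step,
        and runs from \<open>h x\<close> at \<open>q a\<close> to more than \<open>r\<close> at
        \<open>q b\<close>.\<close>
      have "\<exists>i\<le>Suc r. ?d x (q i) = t"
      proof (rule discrete_ivt[where a = a and b = b])
        fix i assume i: "i < Suc r"
        have V: "q i \<in> ?V" "q (Suc i) \<in> ?V" using i q by auto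
        have "?d (q i) (q (Suc i)) = 1" "?d (q (Suc i)) (q i) = 1" using i qd' by auto
        then show "?d x (q (Suc i)) \<le> Suc (?d x (q i)) \<and> ?d x (q i) \<le> Suc (?d x (q (Suc i)))"
          using dist_triangle[OF G x(1) V] dist_triangle[OF G x(1) V(2,1)] by simp
      qed (use a b t False in auto)
      then show ?thesis using t q by (force simp: A_def Q_def image_iff)
    qed
    then have "{2..r} \<subseteq> ?d x ` A x" by auto
    then have "card {2..r} \<le> card (A x)" using finA surj_card_le by blast
    then show ?thesis by simp
  next
    case False
    \<comment> \<open>All of \<open>Q\<close> is now within distance \<open>r\<close> of
      \<open>x\<close>, so only the vertices at distance at most 1 are missing from
      \<open>A x\<close>. Any two of these are at distance at most 2, so their indices fit into a
      window of three, leaving \<open>r + 2 - 3\<close> members.\<close>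
    define N where "N = {i. i \<le> Suc r \<and> ?d x (q i) \<le> 1}"
    have finN: "finite N" by (simp add: N_def)
    have "card N \<le> 3"
    proof (cases "N = {}")
      case False
      define i where "i = Min N"
      have i: "i \<in> N" using False finN by (simp add: i_def)
      have "j \<in> {i..i+2}" if j: "j \<in> N" for j
      proof -
        have "i \<le> j" using j finN by (simp add: i_def)
        moreover have "?d (q i) (q j) \<le> ?d (q i) x + ?d x (q j)"
          using dist_triangle[OF G] i j x q by (auto simp: N_def)
        ultimately show ?thesis
          using i j qd[of j i] graph_dist_commute[of G x "q i"] by (auto simp: N_def)
      qed
      then have "card N \<le> card {i..i+2}" by (intro card_mono) auto
      then show ?thesis by simp
    qed simp
    moreover have "q ` ({..Suc r} - N) \<subseteq> A x"
      using False q by (auto simp: A_def N_def Q_def not_less)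
    then have "card (q ` ({..Suc r} - N)) \<le> card (A x)" using finA by (rule card_mono[rotated])
    moreover have "card (q ` ({..Suc r} - N)) = card ({..Suc r} - N)"
      by (intro card_image inj_on_subset[OF inj]) auto
    moreover have "card ({..Suc r} - N) = r + 2 - card N"
      using finN by (subst card_Diff_subset) (auto simp: N_def)
    ultimately show ?thesis by linarith
  qed
  \<comment> \<open>\<open>M1\<close> holds the mid pairs inside \<open>Q\<close>, and
    \<open>M2\<close> those found from vertices outside \<open>Q\<close>; every pair in
    \<open>M2\<close> has an end outside \<open>Q\<close>, so the two are disjoint.\<close>
  define M1 where "M1 = nsets Q 2 \<inter> mid_pairs G r"
  define M2 where "M2 = (\<lambda>(x, y). {x, y}) ` (SIGMA x:?V - Q. A x)"
  have fin_mid: "finite (mid_pairs G r)"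
    using finV by (simp add: mid_pairs_def finite_imp_finite_nsets)
  \<comment> \<open>The exceptions on the geodesic are the \<open>r + 1\<close> consecutive pairs
    and the pair of its two ends.\<close>
  have "nsets Q 2 - M1 \<subseteq> insert {q 0, q (Suc r)} ((\<lambda>i. {q i, q (Suc i)}) ` {..r})"
  proof
    fix p assume p: "p \<in> nsets Q 2 - M1"
    then obtain i j where ij: "i < j" "j \<le> Suc r" "p = {q i, q j}"
      unfolding Q_def in_nsets_2_iff
      by (smt (verit, best) DiffD1 atMost_iff imageE in_nsets_2_iff insert_commute nat_neq_iff)
    then have "p \<in> nsets ?V 2" using p QV by (auto simp: in_nsets_2_iff)
    then have "\<not> (2 \<le> j - i \<and> j - i \<le> r)"
      using p qd[of j i] ij by (auto simp: M1_def mid_pairs_def pair_dist_eq)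
    then have "j = Suc i \<or> (i = 0 \<and> j = Suc r)" using ij by linarith
    then show "p \<in> insert {q 0, q (Suc r)} ((\<lambda>i. {q i, q (Suc i)}) ` {..r})" using ij by auto
  qed
  then have "card (nsets Q 2 - M1)
      \<le> card (insert {q 0, q (Suc r)} ((\<lambda>i. {q i, q (Suc i)}) ` {..r}))"
    by (intro card_mono) auto
  also have "\<dots> \<le> Suc (card ((\<lambda>i. {q i, q (Suc i)}) ` {..r}))" by (rule card_insert_le_m1) auto
  also have "\<dots> \<le> r + 2" using card_image_le[of "{..r}" "\<lambda>i. {q i, q (Suc i)}"] by simp
  finally have "card (nsets Q 2 - M1) \<le> r + 2" .
  moreover have "card (nsets Q 2 - M1) = (r + 2 choose 2) - card M1"
    using fin_mid cardQ by (subst card_Diff_subset) (auto simp: M1_def card_nsets)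
  ultimately have M1: "(r + 2 choose 2) \<le> card M1 + (r + 2)" by linarith
  have "inj_on (\<lambda>(x, y). {x, y}) (SIGMA x:?V - Q. A x)"
    by (auto simp: inj_on_def doubleton_eq_iff A_def)
  then have "card M2 = (\<Sum>x\<in>?V - Q. card (A x))"
    unfolding M2_def using finV finA by (simp add: card_image card_SigmaI)
  also have "\<dots> \<ge> (\<Sum>x\<in>?V - Q. r - 1)" using card_A by (intro sum_mono) auto
  finally have "card (?V - Q) * (r - 1) \<le> card M2" by simp
  moreover have "card (?V - Q) = graph_order G - (r + 2)"
    using QV finQ cardQ by (simp add: card_Diff_subset graph_order_def)
  ultimately have M2: "(graph_order G - (r + 2)) * (r - 1) \<le> card M2" by simp
  have "M2 \<subseteq> mid_pairs G r"
  proof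
    fix p assume "p \<in> M2"
    then obtain x y where xy: "x \<in> ?V" "y \<in> A x" "p = {x, y}" by (auto simp: M2_def)
    then have "x \<noteq> y" using dist_self[OF G, of x] by (auto simp: A_def)
    then show "p \<in> mid_pairs G r"
      using xy by (auto simp: A_def mid_pairs_def pair_dist_eq in_nsets_2_iff)
  qed
  moreover have "M1 \<inter> M2 = {}"
    by (auto simp: M1_def M2_def in_nsets_2_iff doubleton_eq_iff)
  moreover have "M1 \<subseteq> mid_pairs G r" by (auto simp: M1_def)
  ultimately have "card M1 + card M2 \<le> card (mid_pairs G r)"
    using fin_mid by (metis card_Un_disjoint card_mono finite_subset Un_least)
  then show "?lhs \<le> card (mid_pairs G r) + (r + 2)" using M1 M2 by simp
qed

text \<open>This is the arithmetic for order \<open>n = r + 2 + s\<close>, where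
  \<open>n - r = s + 2\<close>, written without subtracting binomials. Raising \<open>s\<close> by
  one adds \<open>r + 2 + s\<close> to both sides.\<close>

lemma choose_two_split:
  assumes "1 \<le> r"
  shows "(r + 2 + s choose 2) + (r + 2) + 1
    = (s + 2 choose 2) + (r + 2 + s) + (r + 2 choose 2) + s * (r - 1)"
proof (induction s)
  case (Suc s)
  have "(Suc k choose 2) = k + (k choose 2)" for k by (simp add: numeral_2_eq_2)
  from this[of "r + 2 + s"] this[of "s + 2"] Suc assms show ?case by simp
qed (simp add: numeral_2_eq_2)

text \<open>A far pair supplies a geodesic, whose first \<open>r + 2\<close> vertices yield the
  bound on mid pairs; the partition of all pairs turns it into this bound.\<close>

lemma card_far_pairs_le:
  assumes G: "connected_graph G" and r: "1 \<le> r" and ne: "far_pairs G r \<noteq> {}"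
  shows "card (far_pairs G r) + graph_size G + 1
    \<le> (graph_order G - r choose 2) + graph_order G"
proof -
  obtain u v where uv: "u \<in> verts G" "v \<in> verts G" "r < graph_dist G u v"
    using ne by (auto simp: far_pairs_def in_nsets_2_iff pair_dist_eq)
  then obtain q where q: "\<forall>i\<le>graph_dist G u v. q i \<in> verts G"
    "\<forall>j\<le>graph_dist G u v. \<forall>i\<le>j. graph_dist G (q i) (q j) = j - i"
    using geodesic[OF G uv(1,2)] by blast
  have mid: "(Suc (Suc r) choose 2) + (graph_order G - (r + 2)) * (r - 1)
      \<le> card (mid_pairs G r) + (r + 2)" and n: "r + 2 \<le> graph_order G"
    using card_mid_pairs_ge[OF G r, of q] q uv(3) by auto
  obtain s where s: "graph_order G = r + 2 + s" using n le_Suc_ex by blast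
  show ?thesis
    using mid card_far_mid_edges[OF G r] choose_two_split[OF r, of s] unfolding s
    by (simp add: add.commute)
qed

section \<open>Distances in path-complete graphs\<close>

lemma path_complete_connected:
  assumes "path_complete P"
  shows "connected_graph P"
proof -
  obtain ps K S where P: "ps \<noteq> []" "distinct ps" "finite K" "set ps \<inter> K = {}" "S \<subseteq> K" "S \<noteq> {}"
    and Peq: "P = (set ps \<union> K, path_edges ps \<union> nsets K 2 \<union> (\<lambda>s. {last ps, s}) ` S)"
    using assms unfolding path_complete_def by blast
  have simple: "simple_graph P"
  proof -
    have "path_edges ps \<subseteq> nsets (set ps \<union> K) 2"
    proof
      fix e assume "e \<in> path_edges ps"
      then obtain i where "Suc i < length ps" "e = {ps ! i, ps ! Suc i}"
        by (auto simp: path_edges_def)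
      moreover from this have "ps ! i \<noteq> ps ! Suc i" using P(2) by (simp add: nth_eq_iff_index_eq)
      ultimately show "e \<in> nsets (set ps \<union> K) 2"
        by (force simp: in_nsets_2_iff)
    qed
    moreover have "nsets K 2 \<subseteq> nsets (set ps \<union> K) 2" by (rule nsets_mono) auto
    moreover have "(\<lambda>s. {last ps, s}) ` S \<subseteq> nsets (set ps \<union> K) 2"
    proof
      fix e assume "e \<in> (\<lambda>s. {last ps, s}) ` S"
      then obtain s where "s \<in> S" "e = {last ps, s}" by blast
      moreover from this have "last ps \<noteq> s" using P(4,5) last_in_set[OF P(1)] by blast
      ultimately show "e \<in> nsets (set ps \<union> K) 2"
        using P(5) last_in_set[OF P(1)] unfolding in_nsets_2_iff by blast
    qed
    ultimately show ?thesis using P(3) by (simp add: simple_graph_def Peq)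
  qed
  obtain s where s: "s \<in> S" using P by blast
  \<comment> \<open>It suffices that every vertex reaches one fixed \<open>s\<close> in
    \<open>S\<close>; reversal and transitivity then connect any two vertices.\<close>
  define R where "R u \<longleftrightarrow> (\<exists>xs. path_between P u s xs)" for u
  have step: "R w" if "{w, u} \<in> edges P" "R u" for u w
    using that path_between_step simple_graph_edgeD[OF simple that(1)] unfolding R_def by metis
  have "path_between P s s [s]" using s P by (auto simp: path_between_def Peq)
  then have Rs: "R s" unfolding R_def by blast
  have RK: "R k" if "k \<in> K" for k
  proof (cases "k = s")
    case False
    then have "{k, s} \<in> edges P" using that s P(5) by (auto simp: Peq in_nsets_2_iff)
    then show ?thesis using step Rs by blast
  qed (use Rs in simp)
  \<comment> \<open>The index \<open>i\<close> counts backwards from \<open>last ps\<close>, which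
    is adjacent to \<open>s\<close>.\<close>
  have Rps: "R (ps ! (length ps - 1 - i))" if "i < length ps" for i
    using that
  proof (induction i)
    case 0
    have "{last ps, s} \<in> edges P" using s by (auto simp: Peq)
    then show ?case using step[of "last ps" s] Rs P(1) by (simp add: last_conv_nth)
  next
    case (Suc i)
    define j where "j = length ps - 1 - Suc i"
    have j: "Suc j = length ps - 1 - i" "Suc j < length ps" using Suc.prems by (auto simp: j_def)
    then have "{ps ! j, ps ! Suc j} \<in> edges P" by (auto simp: Peq path_edges_def)
    then show ?case using step Suc j unfolding j_def[symmetric] by (metis Suc_lessD)
  qed
  have "R u" if u: "u \<in> verts P" for u
  proof (cases "u \<in> K")
    case False
    then obtain j where j: "j < length ps" "u = ps ! j"
      using u by (auto simp: Peq in_set_conv_nth)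
    then show ?thesis using Rps[of "length ps - 1 - j"] by simp
  qed (rule RK)
  then have "\<exists>xs. path_between P u v xs" if "u \<in> verts P" "v \<in> verts P" for u v
    using that path_between_rev path_between_trans unfolding R_def by metis
  moreover have "verts P \<noteq> {}" using P by (simp add: Peq)
  ultimately show ?thesis using simple by (simp add: connected_graph_def)
qed

text \<open>The three families are disjoint: path edges lie within \<open>set ps\<close>, clique
  edges within \<open>K\<close>, and the joining edges cross between them.\<close>

lemma card_path_complete_edges:
  assumes "ps \<noteq> []" "distinct ps" "finite K" "set ps \<inter> K = {}" "S \<subseteq> K"
  shows "card (path_edges ps \<union> nsets K 2 \<union> (\<lambda>s. {last ps, s}) ` S)
    = (length ps - 1) + (card K choose 2) + card S"
proof -
  have last: "last ps \<notin> K" "last ps \<in> set ps" using assms last_in_set by blast+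
  have sub: "e \<subseteq> set ps" "e \<noteq> {}" if "e \<in> path_edges ps" for e
    using that by (auto simp: path_edges_def)
  then have "path_edges ps \<subseteq> Pow (set ps)" by auto
  then have "finite (path_edges ps)" by (rule finite_subset) simp
  moreover have "finite (nsets K 2)" using assms by (simp add: finite_imp_finite_nsets)
  moreover have "path_edges ps \<inter> nsets K 2 = {}"
    using sub assms by (fastforce simp: nsets_def)
  moreover have "(path_edges ps \<union> nsets K 2) \<inter> (\<lambda>s. {last ps, s}) ` S = {}"
    using sub assms last by (fastforce simp: nsets_def)
  moreover have "finite S" using assms finite_subset by blast
  moreover have "card ((\<lambda>s. {last ps, s}) ` S) = card S"
    by (intro card_image) (auto simp: inj_on_def doubleton_eq_iff)
  ultimately show ?thesis
    using assms by (simp add: card_Un_disjoint card_path_edges card_nsets)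
qed

lemma sum_descending_choose_two:
  assumes "t \<le> N"
  shows "(\<Sum>i<t. N - Suc i) + (N - t choose 2) = N choose 2"
  using assms
proof (induction t)
  case (Suc t)
  have "N - t = Suc (N - Suc t)" using Suc.prems by simp
  then have "(N - t choose 2) = (N - Suc t) + (N - Suc t choose 2)"
    by (simp add: numeral_2_eq_2)
  then show ?case using Suc by simp
qed simp

text \<open>This is the reverse of the inequality in \<open>card_far_pairs_le\<close>. Pairs more
  than \<open>r\<close> layers apart are counted by their end in the lower layer, a path
  vertex.\<close>

lemma card_far_pairs_ge:
  assumes "path_complete P" and r: "1 \<le> r"
  shows "(graph_order P - r choose 2) + graph_order P
    \<le> card (far_pairs P r) + graph_size P + 1"
proof -
  obtain ps K S where P: "ps \<noteq> []" "distinct ps" "finite K" "set ps \<inter> K = {}" "S \<subseteq> K" "S \<noteq> {}"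
    and Peq: "P = (set ps \<union> K, path_edges ps \<union> nsets K 2 \<union> (\<lambda>s. {last ps, s}) ` S)"
    using assms(1) unfolding path_complete_def by blast
  note conn = path_complete_connected[OF assms(1)]
  define a k j where "a = length ps" and "k = card K" and "j = card S"
  have a: "1 \<le> a" using P by (cases ps) (auto simp: a_def)
  have j: "1 \<le> j" "j \<le> k"
    using P finite_subset[OF P(5,3)] by (auto simp: j_def k_def card_mono Suc_le_eq card_gt_0_iff)
  have n: "graph_order P = a + k"
    using P by (simp add: graph_order_def Peq card_Un_disjoint distinct_card a_def k_def)
  have m: "graph_size P = (a - 1) + (k choose 2) + j"
    unfolding graph_size_def Peq snd_conv a_def k_def j_def
    using P by (intro card_path_complete_edges)
  show ?thesis
  proof (cases "a < r")
    case True
    \<comment> \<open>For a path shorter than \<open>r\<close> the edges of the clique alone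
      outweigh the left side, since \<open>a + k - r\<close> is at most
      \<open>k - 1\<close>.\<close>
    obtain k' where k': "k = Suc k'" using j by (cases k) auto
    have "a + k - r \<le> k'" using True k' by simp
    then have "(a + k - r choose 2) \<le> (k' choose 2)" by (rule binomial_right_mono)
    moreover have "(k choose 2) = k' + (k' choose 2)" by (simp add: k' numeral_2_eq_2)
    ultimately show ?thesis using k' j a unfolding n m by linarith
  next
    case False
    \<comment> \<open>The layers are the positions \<open>0\<close> to \<open>a - 1\<close> on the
      path, then \<open>a\<close> for \<open>S\<close> and \<open>Suc a\<close> for the rest of
      \<open>K\<close>.\<close>
    define L where "L x = (if x \<in> set ps then the_inv_into {..<a} ((!) ps) x
      else if x \<in> S then a else Suc a)" for x
    have inj: "inj_on ((!) ps) {..<a}" using P(2) by (simp add: inj_on_nth a_def)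
    have L_nth: "L (ps ! i) = i" if "i < a" for i
      using that the_inv_into_f_f[OF inj, of i] by (simp add: L_def a_def)
    have L_S: "L x = a" if "x \<in> S" for x using that P by (auto simp: L_def)
    have L_K: "L x = Suc a" if "x \<in> K - S" for x using that P by (auto simp: L_def)
    have L_last: "L (last ps) = a - 1"
      using L_nth[of "a - 1"] a P(1) by (simp add: last_conv_nth a_def)
    have L_edge: "L y \<le> Suc (L x)" if e: "{x, y} \<in> edges P" for x y
    proof -
      consider i where "Suc i < a" "{x, y} = {ps ! i, ps ! Suc i}"
        | "x \<in> K" "y \<in> K" | s where "s \<in> S" "{x, y} = {last ps, s}"
        using e unfolding Peq path_edges_def a_def in_nsets_2_iff by (auto simp: doubleton_eq_iff)
      then show ?thesis
      proof cases
        case 1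
        then show ?thesis using L_nth[of i] L_nth[of "Suc i"] by (auto simp: doubleton_eq_iff)
      next
        case 2
        then show ?thesis using L_S L_K by (metis DiffI le_SucI le_refl)
      next
        case 3
        then show ?thesis using L_S L_last by (auto simp: doubleton_eq_iff)
      qed
    qed
    define B where "B i = {y \<in> verts P. i + r < L y}" for i
    have fin: "finite (verts P)" by (rule finite_verts[OF conn])
    have finB: "finite (B i)" for i using fin by (simp add: B_def)
    have "(\<lambda>(i, y). {ps ! i, y}) ` (SIGMA i:{..<a}. B i) \<subseteq> far_pairs P r"
    proof clarsimp
      fix i y assume i: "i < a" and y: "y \<in> B i"
      have V: "ps ! i \<in> verts P" "y \<in> verts P" using i y by (auto simp: Peq a_def B_def)
      then have "L y \<le> L (ps ! i) + graph_dist P (ps ! i) y"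
        using dist_ge_layer_difference[OF conn] L_edge by blast
      then have "r < graph_dist P (ps ! i) y" using y i L_nth by (simp add: B_def)
      moreover have "ps ! i \<noteq> y" using y i L_nth by (auto simp: B_def)
      ultimately show "{ps ! i, y} \<in> far_pairs P r"
        using V by (auto simp: far_pairs_def in_nsets_2_iff pair_dist_eq)
    qed
    \<comment> \<open>The vertex \<open>y\<close> lies in a strictly higher layer than
      \<open>ps ! i\<close>, so the pair determines its ordering.\<close>
    moreover have "inj_on (\<lambda>(i, y). {ps ! i, y}) (SIGMA i:{..<a}. B i)"
    proof (rule inj_onI, clarsimp simp: doubleton_eq_iff, elim disjE conjE)
      fix i y i' y' assume *: "i < a" "y \<in> B i" "i' < a" "y' \<in> B i'"
      show "i = i' \<and> y = y'" if "ps ! i = ps ! i'" "y = y'"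
        using that * inj by (auto simp: inj_on_def)
      show "i = i' \<and> y = y'" if "ps ! i = y'" "y = ps ! i'"
        using that * L_nth by (fastforce simp: B_def)
    qed
    ultimately have "card (SIGMA i:{..<a}. B i) \<le> card (far_pairs P r)"
      using fin by (intro card_inj_on_le) (auto simp: far_pairs_def finite_imp_finite_nsets)
    then have "(\<Sum>i<a. card (B i)) \<le> card (far_pairs P r)" using finB by (simp add: card_SigmaI)
    \<comment> \<open>The top layer is \<open>Suc a\<close>, so \<open>a - r\<close> is the last
      index that can contribute.\<close>
    moreover have "(\<Sum>i<Suc (a - r). card (B i)) \<le> (\<Sum>i<a. card (B i))"
      using r a by (intro sum_mono2) auto
    \<comment> \<open>Here \<open>i + r < a\<close>, so \<open>B i\<close> misses only the first
      \<open>i + r + 1\<close> path vertices.\<close>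
    moreover have "a + k - r - Suc i \<le> card (B i)" if i: "i < a - r" for i
    proof -
      have "verts P - (!) ps ` {..i + r} \<subseteq> B i"
      proof
        fix y assume y: "y \<in> verts P - (!) ps ` {..i + r}"
        have "i + r < L y"
        proof (cases "y \<in> K")
          case True
          then show ?thesis using L_S[of y] L_K[of y] i by (cases "y \<in> S") auto
        next
          case False
          then obtain l where "l < a" "y = ps ! l"
            using y by (auto simp: Peq in_set_conv_nth a_def)
          then show ?thesis using y L_nth by auto
        qed
        then show "y \<in> B i" using y by (simp add: B_def)
      qed
      then have "card (verts P - (!) ps ` {..i + r}) \<le> card (B i)" using finB by (rule card_mono[rotated])
      moreover have "card (verts P) - card ((!) ps ` {..i + r}) \<le> card (verts P - (!) ps ` {..i + r})"
        by (rule diff_card_le_card_Diff) simp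
      moreover have "card ((!) ps ` {..i + r}) \<le> Suc (i + r)"
        using card_image_le[of "{..i + r}" "(!) ps"] by simp
      ultimately show ?thesis using n by (simp add: graph_order_def)
    qed
    then have "(\<Sum>i<a - r. a + k - r - Suc i) \<le> (\<Sum>i<a - r. card (B i))" by (intro sum_mono) auto
    moreover have "(\<Sum>i<a - r. a + k - r - Suc i) + (k choose 2) = a + k - r choose 2"
      using sum_descending_choose_two[of "a - r" "a + k - r"] False by simp
    \<comment> \<open>At \<open>i = a - r\<close> the threshold is the layer of \<open>S\<close>, so
      the vertices of \<open>K - S\<close> still count.\<close>
    moreover have "k \<le> card (B (a - r)) + j"
    proof -
      have "K - S \<subseteq> B (a - r)" using L_K False by (auto simp: B_def Peq)
      then have "card (K - S) \<le> card (B (a - r))" using finB by (rule card_mono[rotated])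
      then show ?thesis
        using P finite_subset[OF P(5,3)] by (simp add: card_Diff_subset k_def j_def)
    qed
    ultimately have "(a + k - r choose 2) + k \<le> card (far_pairs P r) + (k choose 2) + j"
      unfolding sum.lessThan_Suc by linarith
    then show ?thesis using a unfolding n m by simp
  qed
qed

section \<open>Comparing distance sequences\<close>

lemma length_filter_distance_sequence:
  assumes "finite (verts G)"
  shows "length (filter (\<lambda>x. r < x) (distance_sequence G)) = card (far_pairs G r)"
proof -
  have "length (filter (\<lambda>x. r < x) (distance_sequence G))
      = size (filter_mset (\<lambda>x. r < x) (mset (distance_sequence G)))"
    by (metis mset_filter size_mset)
  also have "\<dots> = card (far_pairs G r)"
    using assms by (simp add: distance_sequence_def filter_mset_image_mset
        filter_mset_mset_set finite_imp_finite_nsets far_pairs_def)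
  finally show ?thesis .
qed

text \<open>If \<open>xs ! i\<close> exceeded \<open>r = ys ! i\<close>, all entries of
  \<open>xs\<close> from \<open>i\<close> on would exceed \<open>r\<close>, but in \<open>ys\<close>
  only entries strictly after \<open>i\<close> can.\<close>

lemma sorted_nth_le_if_filter_le:
  fixes xs ys :: "'a :: linorder list"
  assumes sorted: "sorted xs" "sorted ys" and len: "length xs = length ys"
    and cnt: "\<And>r. length (filter (\<lambda>x. r < x) xs) \<le> length (filter (\<lambda>x. r < x) ys)"
    and i: "i < length xs"
  shows "xs ! i \<le> ys ! i"
proof (rule ccontr)
  assume "\<not> xs ! i \<le> ys ! i"
  define r where "r = ys ! i"
  have "{i..<length xs} \<subseteq> {l. l < length xs \<and> r < xs ! l}"
    using \<open>\<not> _\<close> sorted_nth_mono[OF sorted(1), of i] by (fastforce simp: r_def)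
  then have "card {i..<length xs} \<le> length (filter (\<lambda>x. r < x) xs)"
    unfolding length_filter_conv_card by (intro card_mono) auto
  moreover have "{l. l < length ys \<and> r < ys ! l} \<subseteq> {Suc i..<length ys}"
    using sorted_nth_mono[OF sorted(2), of _ i] i len by (fastforce simp: r_def not_less_eq_eq)
  then have "length (filter (\<lambda>x. r < x) ys) \<le> card {Suc i..<length ys}"
    unfolding length_filter_conv_card by (intro card_mono) auto
  ultimately show False using cnt[of r] i len by simp
qed

text \<open>The entries of \<open>xs\<close> are replaced by those of \<open>ys\<close> one by one
  from the left; all intermediate lists stay positive, as coordinatewise monotonicity
  demands.\<close>

lemma nondecreasing_coords_mono:
  assumes g: "nondecreasing_coords g" and len: "length xs = length ys"
    and le: "\<And>i. i < length xs \<Longrightarrow> xs ! i \<le> ys ! i" and pos: "\<forall>x\<in>set xs. 0 < x"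
  shows "g xs \<le> g ys"
proof -
  have pos': "\<forall>y\<in>set ys. 0 < y"
    using le pos len by (metis in_set_conv_nth order_less_le_trans)
  have "g xs \<le> g (take i ys @ drop i xs)" if "i \<le> length xs" for i
    using that
  proof (induction i)
    case (Suc i)
    let ?zs = "take i ys @ drop i xs"
    have "\<forall>x\<in>set ?zs. 0 < x" using pos pos' by (auto dest: in_set_takeD in_set_dropD)
    moreover have "?zs ! i \<le> ys ! i" "i < length ?zs"
      using Suc.prems le[of i] len by (auto simp: nth_append)
    ultimately have "g ?zs \<le> g (?zs[i := ys ! i])" using g unfolding nondecreasing_coords_def by blast
    also have "?zs[i := ys ! i] = take (Suc i) ys @ drop (Suc i) xs"
      using Suc.prems len
      by (simp add: list_update_append take_Suc_conv_app_nth flip: Cons_nth_drop_Suc)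
    finally show ?case using Suc by simp
  qed simp
  from this[of "length xs"] len show ?thesis by simp
qed

lemma nondecreasing_coords_uminus:
  "nondecreasing_coords (\<lambda>xs. - g xs) \<longleftrightarrow> nonincreasing_coords g"
  by (simp add: nondecreasing_coords_def nonincreasing_coords_def)

theorem theorem1:
  fixes n m :: nat and G P :: "'a ugraph" and I :: "'a ugraph \<Rightarrow> real"
  assumes "n - 1 \<le> m" and "m < n choose 2"
    and "connected_graph G" and "graph_order G = n" and "graph_size G = m"
    and "is_PK n m P"
  shows "(nondecreasing_distance_based I \<longrightarrow> I G \<le> I P) \<and>
         (nonincreasing_distance_based I \<longrightarrow> I G \<ge> I P)"
proof -
  note G = assms(3)
  have P: "path_complete P" "graph_order P = n" "graph_size P = m"
    using assms(6) by (auto simp: is_PK_def)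
  note connP = path_complete_connected[OF P(1)]
  \<comment> \<open>The two bounds meet at the same function of \<open>n\<close>, \<open>m\<close>
    and \<open>r\<close>. For \<open>r = 0\<close> both graphs count all pairs.\<close>
  have far: "card (far_pairs G r) \<le> card (far_pairs P r)" for r
  proof (cases "1 \<le> r \<and> far_pairs G r \<noteq> {}")
    case True
    then show ?thesis
      using card_far_pairs_le[OF G, of r] card_far_pairs_ge[OF P(1), of r] assms(4,5) P by simp
  next
    case False
    then consider "r = 0" | "far_pairs G r = {}" by fastforce
    then show ?thesis
      using card_far_pairs_0[OF G] card_far_pairs_0[OF connP] assms(4) P(2) by cases auto
  qed
  let ?xs = "distance_sequence G" and ?ys = "distance_sequence P"
  have fin: "finite (verts G)" "finite (verts P)" by (rule finite_verts[OF G], rule finite_verts[OF connP])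
  have len: "length ?xs = length ?ys"
    using length_distance_sequence fin assms(4) P(2) by metis
  have le: "?xs ! i \<le> ?ys ! i" if "i < length ?xs" for i
  proof (rule sorted_nth_le_if_filter_le[OF _ _ len _ that])
    show "sorted ?xs" "sorted ?ys" by (simp_all add: distance_sequence_def)
  qed (simp add: length_filter_distance_sequence fin far)
  have pos: "\<forall>x\<in>set ?xs. 0 < x"
  proof -
    have "length (filter (\<lambda>x. 0 < x) ?xs) = length ?xs"
      using fin by (simp add: length_filter_distance_sequence card_far_pairs_0[OF G]
          length_distance_sequence)
    then show ?thesis by (metis filter_True length_filter_less less_irrefl)
  qed
  have mono: "g ?xs \<le> g ?ys" if "nondecreasing_coords g" for g
    using nondecreasing_coords_mono[OF that len le pos] .
  show ?thesis
  proof (intro conjI impI)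
    assume "nondecreasing_distance_based I"
    then obtain g where g: "index_via g I" "nondecreasing_coords g"
      by (auto simp: nondecreasing_distance_based_def)
    then show "I G \<le> I P" using mono G connP unfolding index_via_def by metis
  next
    assume "nonincreasing_distance_based I"
    then obtain g where g: "index_via g I" "nonincreasing_coords g"
      by (auto simp: nonincreasing_distance_based_def)
    have "g ?ys \<le> g ?xs"
      using mono[of "\<lambda>xs. - g xs"] g(2) by (simp add: nondecreasing_coords_uminus)
    then show "I G \<ge> I P" using g(1) G connP unfolding index_via_def by metis
  qed
qed

end
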